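(* (John--Nirenberg inequality) Let $T$ be a tree rooted at infinity with vertex set $V$, endowed with a locally doubling flow measure $m$, and let $\mathcal R$ be the family of admissible trapezoids. There exist $\eta,A>0$ such that for all $f\in BMO_1(m)$: (i) if $f$ is not constant, $\displaystyle\sup_{R\in\mathcal R}\frac1{m(R)}\int_R\exp\left(\frac{\eta}{\|f\|_{BMO_1}}|f-f_R|\right)dm\le A$; (ii) $m(\{x\in R:\ |f(x)-f_R|>t\|f\|_{BMO_1}\})\le A e^{-\eta t}m(R)$ for all $t>0$ and all $R\in\mathcal R$.
   Context: Tree with root at infinity: $T=(V,E)$ is an (undirected) tree with geodesic distance $d$, $o\in V$ is a fixed origin, and a half-infinite geodesic starting at $o$ is fixed, identified with a boundary point, the root. For $x\in V$ let $\Pi(x)$ be the vertex of this geodesic closest to $x$; the level of $x$ is $\ell(x)=d(o,\Pi(x))-d(\Pi(x),x)$. Write $x\ge y$ iff $\ell(x)-\ell(y)=d(x,y)$. The set of sons of $x$ is $s(x)=\{y\sim x:\ \ell(y)=\ell(x)-1\}$. Flow measure: a function $m:V\to(0,\infty)$ with $m(x)=\sum_{y\in s(x)}m(y)$ for all $x\in V$; also regarded as the measure $m(A)=\sum_{x\in A}m(x)$, with $\int_A f\,dm=\sum_{y\in A}f(y)m(y)$. It is locally doubling if for every $r>0$ there is $C_r>1$ with $m(B_{2r}(x))\le C_r m(B_r(x))$ for all $x\in V$, where $B_r(x)$ is the closed ball of radius $r$ for $d$. Admissible trapezoids: for integers $h''>h'\ge1$ and $x_0\in V$, $R_{h'}^{h''}(x_0)=\{x\in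 V:\ x\le x_0,\ \ell(x_0)-h''<\ell(x)\le \ell(x_0)-h'\}$. Fix $\beta\ge12$. $\mathcal R$ is the family of all singletons $\{x_0\}$ and all $R_{h'}^{h''}(x_0)$ with $2\le h''/h'\le\beta$, $x_0\in V$. $BMO_1(m)$: $f_R=\frac1{m(R)}\int_R f\,dm$; $BMO_1(m)$ is the space of functions $f:V\to\mathbb C$ with $\|f\|_{BMO_1}=\sup_{R\in\mathcal R}\frac1{m(R)}\int_R|f-f_R|\,dm<\infty$, modulo constants. *)

theory Defs
  imports "HOL-Analysis.Analysis"
begin

text \<open>
  The vertex set \<open>V\<close> is the whole type \<open>'a\<close>. The tree structure is given by its adjacency relation
  \<open>E\<close>, and local finiteness is not assumed.
\<close>

definition graph_tree :: "('a \<Rightarrow> 'a \<Rightarrow> bool) \<Rightarrow> bool" where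
  "graph_tree E \<longleftrightarrow>
     symp E \<and> irreflp E \<and>
     (\<forall>x y. E\<^sup>*\<^sup>* x y) \<and>
     \<not> (\<exists>vs. 3 \<le> length vs \<and> distinct vs \<and> successively E vs \<and> E (last vs) (hd vs))"

definition gdist :: "('a \<Rightarrow> 'a \<Rightarrow> bool) \<Rightarrow> 'a \<Rightarrow> 'a \<Rightarrow> nat" where
  "gdist E x y = (LEAST n. (E ^^ n) x y)"

definition gball :: "('a \<Rightarrow> 'a \<Rightarrow> bool) \<Rightarrow> real \<Rightarrow> 'a \<Rightarrow> 'a set" where
  "gball E r x = {y. real (gdist E x y) \<le> r}"

text \<open>
  The half-infinite geodesic \<open>w\<close> carries both the origin \<open>w 0\<close> and the root, its boundary point.
\<close>

definition geodesic_ray :: "('a \<Rightarrow> 'a \<Rightarrow> bool) \<Rightarrow> (nat \<Rightarrow> 'a) \<Rightarrow> bool" where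
  "geodesic_ray E w \<longleftrightarrow> (\<forall>i j. int (gdist E (w i) (w j)) = \<bar>int i - int j\<bar>)"

definition ray_proj :: "('a \<Rightarrow> 'a \<Rightarrow> bool) \<Rightarrow> (nat \<Rightarrow> 'a) \<Rightarrow> 'a \<Rightarrow> 'a" where
  "ray_proj E w x = arg_min_on (gdist E x) (range w)"

definition level :: "('a \<Rightarrow> 'a \<Rightarrow> bool) \<Rightarrow> (nat \<Rightarrow> 'a) \<Rightarrow> 'a \<Rightarrow> int" where
  "level E w x = int (gdist E (w 0) (ray_proj E w x)) - int (gdist E (ray_proj E w x) x)"

definition below :: "('a \<Rightarrow> 'a \<Rightarrow> bool) \<Rightarrow> (nat \<Rightarrow> 'a) \<Rightarrow> 'a \<Rightarrow> 'a \<Rightarrow> bool" where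
  "below E w y x \<longleftrightarrow> level E w x - level E w y = int (gdist E x y)"

definition sons :: "('a \<Rightarrow> 'a \<Rightarrow> bool) \<Rightarrow> (nat \<Rightarrow> 'a) \<Rightarrow> 'a \<Rightarrow> 'a set" where
  "sons E w x = {y. E x y \<and> level E w y = level E w x - 1}"

text \<open>
  The sum over the sons is a \<open>has_sum\<close>, so that vertices with infinitely many sons are not excluded by
  the convention that a \<open>sum\<close> over an infinite set is zero.
\<close>

definition flow :: "('a \<Rightarrow> 'a \<Rightarrow> bool) \<Rightarrow> (nat \<Rightarrow> 'a) \<Rightarrow> ('a \<Rightarrow> real) \<Rightarrow> bool" where
  "flow E w m \<longleftrightarrow> (\<forall>x. 0 < m x) \<and> (\<forall>x. (m has_sum m x) (sons E w x))"

definition flow_measure :: "('a \<Rightarrow> real) \<Rightarrow> 'a measure" where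
  "flow_measure m = point_measure UNIV (\<lambda>x. ennreal (m x))"

definition locally_doubling :: "('a \<Rightarrow> 'a \<Rightarrow> bool) \<Rightarrow> 'a measure \<Rightarrow> bool" where
  "locally_doubling E M \<longleftrightarrow>
     (\<forall>r>0. \<exists>C>1. \<forall>x. emeasure M (gball E (2 * r) x) \<le> ennreal C * emeasure M (gball E r x))"

definition trapezoid ::
    "('a \<Rightarrow> 'a \<Rightarrow> bool) \<Rightarrow> (nat \<Rightarrow> 'a) \<Rightarrow> nat \<Rightarrow> nat \<Rightarrow> 'a \<Rightarrow> 'a set" where
  "trapezoid E w h' h'' x\<^sub>0 =
     {x. below E w x x\<^sub>0 \<and> level E w x\<^sub>0 - int h'' < level E w x \<and> level E w x \<le> level E w x\<^sub>0 - int h'}"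

definition admissible :: "('a \<Rightarrow> 'a \<Rightarrow> bool) \<Rightarrow> (nat \<Rightarrow> 'a) \<Rightarrow> real \<Rightarrow> 'a set set" where
  "admissible E w \<beta> =
     {{x\<^sub>0} | x\<^sub>0. True} \<union>
     {trapezoid E w h' h'' x\<^sub>0 | h' h'' x\<^sub>0.
        1 \<le> h' \<and> h' < h'' \<and> 2 \<le> real h'' / real h' \<and> real h'' / real h' \<le> \<beta>}"

definition average :: "'a measure \<Rightarrow> 'a set \<Rightarrow> ('a \<Rightarrow> complex) \<Rightarrow> complex" where
  "average M R f = set_lebesgue_integral M R f /\<^sub>R measure M R"

definition bmo_norm :: "'a measure \<Rightarrow> 'a set set \<Rightarrow> ('a \<Rightarrow> complex) \<Rightarrow> ennreal" where
  "bmo_norm M \<R> f =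
     (SUP R\<in>\<R>. (\<integral>\<^sup>+x\<in>R. ennreal (cmod (f x - average M R f)) \<partial>M) / emeasure M R)"

text \<open>
  Representatives only: the quotient by constants is not formed, since \<open>bmo_norm\<close> and
  \<open>f - average M R f\<close> do not change when a constant is added to \<open>f\<close>.
\<close>

definition bmo :: "'a measure \<Rightarrow> 'a set set \<Rightarrow> ('a \<Rightarrow> complex) set" where
  "bmo M \<R> = {f. bmo_norm M \<R> f < \<infinity>}"

end

theory Submission
  imports Defs
begin

text \<open>
  Every admissible trapezoid with more than one vertex is partitioned into smaller admissible sets of
  comparable measure: into singletons if \<open>h' = 1\<close>, into two trapezoids with the same vertex if
  \<open>h'' \<ge> 4 h'\<close>, and otherwise into the trapezoids hanging from the sons of the vertex. Iterating
  such partitions ends in singletons, so the Calderon--Zygmund stopping argument applies: averages over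
  consecutive sets of the partition differ by a bounded multiple of the norm, and the parts where the
  average first leaves the ball of radius 4 times the norm have at most a quarter of the total measure.
  Since all sets are finite, the stopping argument becomes an induction on the cardinality.
\<close>

section \<open>John--Nirenberg inequality for families with splittings\<close>

text \<open>The axioms keep what the stopping argument uses of trapezoids. The condition
  \<open>P \<notin> \<C>\<close> makes every part strictly smaller, so an induction on cardinality
  descends; the mass bound with \<open>c\<close> limits how far the average can jump from a set to
  one of its parts.\<close>

locale splitting_family =
  fixes m :: "'a \<Rightarrow> real" and S :: "'a set set" and c :: real
  assumes m_pos: "0 < m x"
    and finite_member: "P \<in> S \<Longrightarrow> finite P"
    and nonempty_member: "P \<in> S \<Longrightarrow> P \<noteq> {}"
    and c_pos: "0 < c"
    and split: "P \<in> S \<Longrightarrow> (\<exists>x. P = {x}) \<or>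
      (\<exists>\<C>\<subseteq>S. disjoint \<C> \<and> \<Union>\<C> = P \<and> P \<notin> \<C> \<and> (\<forall>C\<in>\<C>. c * sum m P \<le> sum m C))"
begin

definition avg :: "('a \<Rightarrow> complex) \<Rightarrow> 'a set \<Rightarrow> complex" where
  "avg f P = (\<Sum>x\<in>P. m x *\<^sub>R f x) /\<^sub>R sum m P"

lemma sum_m_pos: "P \<in> S \<Longrightarrow> 0 < sum m P"
  using m_pos finite_member nonempty_member by (simp add: sum_pos)

text \<open>Triangle inequality for the weighted sum of \<open>f x - a\<close>. It serves twice: to
  bound the jump of averages from a set to a part, and to turn an average far from \<open>a\<close>
  into a large integral of \<open>cmod (f x - a)\<close>.\<close>

lemma avg_dist_le:
  assumes "P \<in> S"
  shows "sum m P * cmod (avg f P - a) \<le> (\<Sum>x\<in>P. m x * cmod (f x - a))"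
proof -
  have p: "sum m P \<noteq> 0" using sum_m_pos[OF assms] by simp
  have "sum m P *\<^sub>R (avg f P - a) = (\<Sum>x\<in>P. m x *\<^sub>R f x) - sum m P *\<^sub>R a"
    using p by (simp add: avg_def scaleR_diff_right)
  also have "\<dots> = (\<Sum>x\<in>P. m x *\<^sub>R (f x - a))"
    by (simp add: scaleR_diff_right sum_subtractf scaleR_sum_left)
  finally have "cmod (sum m P *\<^sub>R (avg f P - a)) \<le> (\<Sum>x\<in>P. cmod (m x *\<^sub>R (f x - a)))"
    by (simp only: norm_sum)
  then show ?thesis
    using sum_m_pos[OF assms] by (simp add: less_imp_le[OF m_pos] abs_of_nonneg)
qed

lemma avg_singleton: "avg f {x} = f x"
  using m_pos[of x] by (simp add: avg_def)

text \<open>One splitting moves the average by at most \<open>B / c\<close>, so an average that has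
  just left the ball of radius \<open>4 * B\<close> is still within \<open>4 * B + B / c\<close> of
  the centre. The choice of \<open>\<eta>\<close> makes the exponential weight at that distance
  equal to 2. The final factor 4 consists of 2 from each summand in \<open>main\<close>.\<close>

lemma john_nirenberg_sum:
  fixes f :: "'a \<Rightarrow> complex" and B :: real
  defines "\<eta> \<equiv> ln 2 / (4 + 1 / c)"
  assumes B: "0 < B"
    and osc: "\<And>P. P \<in> S \<Longrightarrow> (\<Sum>x\<in>P. m x * cmod (f x - avg f P)) \<le> B * sum m P"
    and P: "P \<in> S"
  shows "(\<Sum>x\<in>P. m x * exp (\<eta> / B * cmod (f x - avg f P))) \<le> 4 * sum m P"
proof -
  define G where "G P a = (\<Sum>x\<in>P. m x * exp (\<eta> / B * cmod (f x - a)))" for P a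
  define L where "L P a = (\<Sum>x\<in>P. m x * cmod (f x - a))" for P a
  have den: "0 < 4 + 1 / c" using c_pos by (simp add: add_pos_pos)
  have \<eta>: "0 < \<eta>" unfolding \<eta>_def using den by simp
  have factor: "exp (\<eta> / B * r) \<le> 2" if "r \<le> 4 * B + B / c" for r
  proof -
    have "\<eta> / B * r \<le> \<eta> / B * (4 * B + B / c)"
      using that \<eta> B by (intro mult_left_mono) auto
    also have "\<dots> = \<eta> * (4 + 1 / c)" using B by (simp add: field_simps)
    also have "\<dots> = ln 2" using den by (simp add: \<eta>_def)
    finally have "exp (\<eta> / B * r) \<le> exp (ln 2)" by (simp only: exp_le_cancel_iff)
    then show ?thesis by simp
  qed
  \<comment> \<open>The second summand pays for the parts whose average has moved away from \<open>a\<close>; this replaces the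
    selection of maximal bad parts.\<close>
  have main: "\<forall>a. cmod (avg f P - a) \<le> 4 * B \<longrightarrow> G P a \<le> 2 * sum m P + 2 / B * L P a" if "P \<in> S" for P
    using that
  proof (induction "card P" arbitrary: P rule: less_induct)
    case less
    note PS = \<open>P \<in> S\<close>
    \<comment> \<open>Centred at its own average, a set has \<open>L\<close> at most
      \<open>B\<close> times its mass, so the second summand contributes at most another
      \<open>2 * sum m Q\<close>.\<close>
    have self: "G Q (avg f Q) \<le> 4 * sum m Q" if "Q \<in> S" "card Q < card P" for Q
    proof -
      have "G Q (avg f Q) \<le> 2 * sum m Q + 2 / B * L Q (avg f Q)"
        using less.hyps[OF that(2,1)] B by simp
      also have "2 / B * L Q (avg f Q) \<le> 2 / B * (B * sum m Q)"
        using osc[OF that(1)] B unfolding L_def by (intro mult_left_mono) auto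
      finally show ?thesis using B by simp
    qed
    show ?case
    proof (intro allI impI)
      fix a assume a: "cmod (avg f P - a) \<le> 4 * B"
      from split[OF PS] show "G P a \<le> 2 * sum m P + 2 / B * L P a"
      proof (elim disjE exE conjE)
        fix x assume x: "P = {x}"
        \<comment> \<open>On a singleton the average is the value of \<open>f\<close>, so the first
          summand alone suffices.\<close>
        have "4 * B \<le> 4 * B + B / c" using B c_pos by simp
        then have "exp (\<eta> / B * cmod (f x - a)) \<le> 2"
          using a x avg_singleton by (intro factor) auto
        then have "m x * exp (\<eta> / B * cmod (f x - a)) \<le> m x * 2"
          using m_pos[of x] by simp
        moreover have "0 \<le> 2 / B * (m x * cmod (f x - a))"
          using B m_pos[of x] by simp
        ultimately show ?thesis unfolding G_def L_def x by simp
      next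
        fix \<C> assume C: "\<C> \<subseteq> S" "disjoint \<C>" "\<Union>\<C> = P" "P \<notin> \<C>" "\<forall>C\<in>\<C>. c * sum m P \<le> sum m C"
        have fin: "\<forall>C\<in>\<C>. finite C" using C(1) finite_member by blast
        have un: "sum g P = (\<Sum>C\<in>\<C>. sum g C)" for g :: "'a \<Rightarrow> real"
          using sum.Union_disjoint[OF fin, of g] C(2,3) by (auto simp: disjoint_def)
        \<comment> \<open>A part whose average is still near \<open>a\<close> keeps this centre and
          inherits the bound by induction; any other part is recentred at its own average.\<close>
        have step: "G C a \<le> 2 * sum m C + 2 / B * L C a" if "C \<in> \<C>" for C
        proof -
          have CS: "C \<in> S" using that C by auto
          have "C \<subset> P" using that C by auto
          then have card: "card C < card P" using finite_member[OF PS] by (rule psubset_card_mono[rotated])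
          have mC: "0 < sum m C" by (rule sum_m_pos[OF CS])
          show ?thesis
          proof (cases "cmod (avg f C - a) \<le> 4 * B")
            case True
            then show ?thesis using less.hyps[OF card CS] by blast
          next
            case False
            \<comment> \<open>The oscillation on \<open>C\<close> is estimated by that on all of
              \<open>P\<close>; dividing by the mass of \<open>C\<close> then costs the factor
              \<open>1 / c\<close>.\<close>
            have "sum m C * cmod (avg f C - avg f P) \<le> (\<Sum>x\<in>C. m x * cmod (f x - avg f P))"
              by (rule avg_dist_le[OF CS])
            also have "\<dots> \<le> (\<Sum>x\<in>P. m x * cmod (f x - avg f P))"
              using \<open>C \<subset> P\<close> finite_member[OF PS] less_imp_le[OF m_pos]
              by (intro sum_mono2) auto
            also have "\<dots> \<le> B * sum m P" by (rule osc[OF PS])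
            also have "\<dots> \<le> B * (sum m C / c)"
              using C(5) that B c_pos by (intro mult_left_mono) (auto simp: field_simps)
            finally have "sum m C * cmod (avg f C - avg f P) \<le> sum m C * (B / c)"
              by (simp add: field_simps)
            then have "cmod (avg f C - avg f P) \<le> B / c"
              using mC by (simp only: mult_le_cancel_left_pos)
            then have jump: "cmod (avg f C - a) \<le> 4 * B + B / c"
              using a norm_triangle_ineq[of "avg f C - avg f P" "avg f P - a"] by simp
            \<comment> \<open>Moving the centre from \<open>a\<close> to \<open>avg f C\<close>
              costs a factor 2, by \<open>factor\<close> and \<open>jump\<close>.\<close>
            have "G C a \<le> (\<Sum>x\<in>C. 2 * (m x * exp (\<eta> / B * cmod (f x - avg f C))))"
              unfolding G_def
            proof (rule sum_mono)
              fix x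
              have "cmod (f x - a) \<le> cmod (f x - avg f C) + cmod (avg f C - a)"
                using norm_triangle_ineq[of "f x - avg f C" "avg f C - a"] by simp
              then have "\<eta> / B * cmod (f x - a) \<le>
                  \<eta> / B * (cmod (f x - avg f C) + cmod (avg f C - a))"
                using \<eta> B by (intro mult_left_mono) auto
              then have "exp (\<eta> / B * cmod (f x - a)) \<le>
                  exp (\<eta> / B * cmod (f x - avg f C)) * exp (\<eta> / B * cmod (avg f C - a))"
                by (simp add: distrib_left exp_add[symmetric])
              also have "\<dots> \<le> exp (\<eta> / B * cmod (f x - avg f C)) * 2"
                using factor[OF jump] by simp
              finally show "m x * exp (\<eta> / B * cmod (f x - a)) \<le>
                  2 * (m x * exp (\<eta> / B * cmod (f x - avg f C)))"
                using m_pos[of x] by simp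
            qed
            also have "\<dots> = 2 * G C (avg f C)" by (simp add: G_def sum_distrib_left)
            also have "\<dots> \<le> 8 * sum m C" using self[OF CS card] by simp
            \<comment> \<open>Recentring doubles the bound 4 to 8, and 8 is \<open>2 / B\<close>
              times the threshold \<open>4 * B\<close>: this is why the second summand alone can
              absorb such a part.\<close>
            also have "8 * sum m C = 2 / B * (sum m C * (4 * B))" using B by simp
            also have "\<dots> \<le> 2 / B * (sum m C * cmod (avg f C - a))"
              using False mC B by (intro mult_left_mono) auto
            also have "\<dots> \<le> 2 / B * L C a"
              using avg_dist_le[OF CS] B unfolding L_def by (intro mult_left_mono) auto
            finally show ?thesis using mC by simp
          qed
        qed
        have "G P a = (\<Sum>C\<in>\<C>. G C a)" unfolding G_def by (rule un)
        also have "\<dots> \<le> (\<Sum>C\<in>\<C>. 2 * sum m C + 2 / B * L C a)" by (rule sum_mono[OF step])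
        also have "\<dots> = 2 * (\<Sum>C\<in>\<C>. sum m C) + 2 / B * (\<Sum>C\<in>\<C>. L C a)"
          by (simp only: sum.distrib sum_distrib_left)
        also have "\<dots> = 2 * sum m P + 2 / B * L P a"
          unfolding L_def using un by simp
        finally show ?thesis .
      qed
    qed
  qed
  have "G P (avg f P) \<le> 2 * sum m P + 2 / B * L P (avg f P)" using main[OF P] B by simp
  also have "2 / B * L P (avg f P) \<le> 2 / B * (B * sum m P)"
    using osc[OF P] B unfolding L_def by (intro mult_left_mono) auto
  finally show ?thesis using B by (simp add: G_def)
qed

end

section \<open>Distances in trees\<close>

locale tree =
  fixes E :: "'a \<Rightarrow> 'a \<Rightarrow> bool"
  assumes tree: "graph_tree E"
begin

abbreviation d where "d \<equiv> gdist E"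

lemma edge_sym: "E x y \<Longrightarrow> E y x"
  using tree by (auto simp: graph_tree_def dest: sympD)

lemma edge_neq: "E x y \<Longrightarrow> x \<noteq> y"
  using tree by (auto simp: graph_tree_def irreflp_def)

lemma no_cycle: "3 \<le> length vs \<Longrightarrow> distinct vs \<Longrightarrow> successively E vs \<Longrightarrow> \<not> E (last vs) (hd vs)"
  using tree unfolding graph_tree_def by blast

lemma gdist_walk: "(E ^^ d x y) x y"
proof -
  have "E\<^sup>*\<^sup>* x y" using tree by (auto simp: graph_tree_def)
  then obtain n where "(E ^^ n) x y" by (metis rtranclp_power)
  then show ?thesis unfolding gdist_def by (rule LeastI)
qed

lemma gdist_le: "(E ^^ n) x y \<Longrightarrow> d x y \<le> n"
  unfolding gdist_def by (rule Least_le)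

lemma relpowp_sym: "(E ^^ n) x y \<Longrightarrow> (E ^^ n) y x"
proof (induction n arbitrary: x y)
  case (Suc n)
  then obtain z where "(E ^^ n) x z" "E z y" by auto
  then have "E y z" "(E ^^ n) z x" using Suc.IH edge_sym by auto
  then show ?case by (rule relpowp_Suc_I2)
qed simp

lemma gdist_sym: "d x y = d y x"
  by (rule antisym) (rule gdist_le[OF relpowp_sym[OF gdist_walk]])+

lemma gdist_triangle: "d x z \<le> d x y + d y z"
proof (rule gdist_le)
  show "(E ^^ (d x y + d y z)) x z"
    using gdist_walk[of x y] gdist_walk[of y z] by (auto simp: relpowp_add)
qed

lemma gdist_self [simp]: "d x x = 0"
  using gdist_le[of 0 x x] by simp

lemma gdist_eq_0: "d x y = 0 \<longleftrightarrow> x = y"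
  using gdist_walk[of x y] by (cases "d x y") auto

lemma gdist_edge: "E x y \<Longrightarrow> d x y = 1"
  using gdist_le[of 1 x y] gdist_eq_0[of x y] edge_neq[of x y] by (cases "d x y") auto

lemma gdist_edge_le: "E x y \<Longrightarrow> d x v \<le> Suc (d y v)"
  using gdist_triangle[of x v y] gdist_edge[of x y] by simp

lemma closer_neighbour:
  assumes "d x v = Suc k"
  obtains y where "E x y" "d y v = k"
proof -
  have "(E ^^ Suc k) x v" using gdist_walk[of x v] assms by simp
  then obtain y where y: "E x y" "(E ^^ k) y v" by (blast elim: relpowp_Suc_E2)
  then have "d y v = k" using gdist_le[OF y(2)] gdist_edge_le[OF y(1), of v] assms by simp
  with y show ?thesis using that by blast
qed

\<comment> \<open>Descend from both points towards \<open>v\<close> until the two descents meet.\<close>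
lemma path_between_equidistant:
  assumes "d a v = k" "d b v = k" "a \<noteq> b"
  shows "\<exists>vs. 3 \<le> length vs \<and> distinct vs \<and> successively E vs \<and> hd vs = a \<and> last vs = b \<and>
    (\<forall>u\<in>set vs. d u v \<le> k)"
  using assms
proof (induction k arbitrary: a b)
  case 0
  then show ?case using gdist_eq_0 by auto
next
  case (Suc k)
  obtain a' where a': "E a a'" "d a' v = k" using closer_neighbour Suc.prems(1) by blast
  obtain b' where b': "E b b'" "d b' v = k" using closer_neighbour Suc.prems(2) by blast
  show ?case
  proof (cases "a' = b'")
    case True
    have "a \<noteq> a'" "b \<noteq> a'" using a' b' True edge_neq by auto
    then show ?thesis
      using a' edge_sym[OF b'(1)] True b'(2) Suc.prems by (intro exI[of _ "[a, a', b]"]) auto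
  next
    case False
    from Suc.IH[OF a'(2) b'(2) False] obtain vs where vs: "3 \<le> length vs" "distinct vs"
      "successively E vs" "hd vs = a'" "last vs = b'" "\<forall>u\<in>set vs. d u v \<le> k" by blast
    have "vs \<noteq> []" using vs(1) by auto
    moreover have "a \<notin> set vs" "b \<notin> set vs" using vs(6) Suc.prems by auto
    ultimately show ?thesis
      using vs Suc.prems a' edge_sym[OF b'(1)]
      by (intro exI[of _ "a # vs @ [b]"])
        (auto simp: successively_append_iff successively_Cons)
  qed
qed

text \<open>The path through points towards \<open>v\<close> that joins two equidistant vertices
  would be closed to a cycle by the edge between them.\<close>

lemma edge_not_equidistant:
  assumes "E a b" shows "d a v \<noteq> d b v"
proof
  assume "d a v = d b v"
  from path_between_equidistant[OF refl this[symmetric] edge_neq[OF assms]] obtain vs where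
    "3 \<le> length vs" "distinct vs" "successively E vs" "hd vs = a" "last vs = b" by blast
  with no_cycle[of vs] edge_sym[OF assms] show False by simp
qed

text \<open>Two different neighbours nearer to \<open>v\<close> are joined by a path staying within
  distance \<open>k\<close> of \<open>v\<close>. It avoids \<open>x\<close>, so adding
  \<open>x\<close> closes a cycle.\<close>

lemma closer_neighbour_unique:
  assumes "E x a" "E x b" "d x v = Suc k" "d a v = k" "d b v = k"
  shows "a = b"
proof (rule ccontr)
  assume "a \<noteq> b"
  with path_between_equidistant[OF assms(4,5)] obtain vs where vs:
    "3 \<le> length vs" "distinct vs" "successively E vs" "hd vs = a" "last vs = b"
    "\<forall>u\<in>set vs. d u v \<le> k" by auto
  have "x \<notin> set vs" using vs(6) assms(3) by auto
  moreover have "vs \<noteq> []" using vs(1) by auto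
  ultimately show False
    using no_cycle[of "x # vs"] vs assms(1) edge_sym[OF assms(2)] by (simp add: successively_Cons)
qed

end

section \<open>Levels and descendants\<close>

locale rooted_tree = tree E for E :: "'a \<Rightarrow> 'a \<Rightarrow> bool" +
  fixes w :: "nat \<Rightarrow> 'a"
  assumes ray: "geodesic_ray E w"
begin

abbreviation lev where "lev \<equiv> level E w"

lemma ray_dist: "int (d (w i) (w j)) = \<bar>int i - int j\<bar>"
  using ray by (simp add: geodesic_ray_def)

lemma ray_edge: "E (w i) (w (Suc i))"
  using gdist_walk[of "w i" "w (Suc i)"] ray_dist[of i "Suc i"] by auto

text \<open>Up to sign, the level is the Busemann function of the ray: beyond the projection of
  \<open>x\<close>, the distance to \<open>w n\<close> grows by one at each step. Later arguments
  work with this formula instead of the projection.\<close>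

lemma level_eventually: "\<exists>n0. \<forall>n\<ge>n0. lev x = int n - int (d x (w n))"
proof -
  have "ray_proj E w x \<in> range w \<and> \<not> (\<exists>y. y \<in> range w \<and> d x y < d x (ray_proj E w x))"
    using arg_min_natI[of "\<lambda>y. y \<in> range w" "w 0" "d x"]
      arg_min_nat_le[of "\<lambda>y. y \<in> range w" _ "d x"]
    unfolding ray_proj_def arg_min_on_def by (auto simp: not_less)
  then obtain n0 where n0: "ray_proj E w x = w n0" "\<And>n. d x (w n0) \<le> d x (w n)"
    by (auto simp: not_less)
  \<comment> \<open>Consecutive distances differ by exactly one. At \<open>n0\<close> minimality
    excludes a decrease; later a decrease would give \<open>w (Suc n)\<close> two different
    neighbours closer to \<open>x\<close>.\<close>
  have grow: "d x (w (Suc n)) = Suc (d x (w n))" if "n \<ge> n0" for n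
    using that
  proof (induction n rule: dec_induct)
    case base
    have "d x (w (Suc n0)) \<le> Suc (d x (w n0))"
      using gdist_edge_le[OF edge_sym[OF ray_edge[of n0]], of x] by (simp add: gdist_sym)
    moreover have "d x (w (Suc n0)) \<noteq> d x (w n0)"
      using edge_not_equidistant[OF ray_edge[of n0], of x] by (simp add: gdist_sym)
    ultimately show ?case using n0(2)[of "Suc n0"] by simp
  next
    case (step n)
    have "d x (w (Suc (Suc n))) \<le> Suc (d x (w (Suc n)))"
      "d x (w (Suc n)) \<le> Suc (d x (w (Suc (Suc n))))"
      using gdist_edge_le[OF edge_sym[OF ray_edge[of "Suc n"]], of x]
        gdist_edge_le[OF ray_edge[of "Suc n"], of x] by (simp_all add: gdist_sym)
    moreover have "d x (w (Suc (Suc n))) \<noteq> d x (w (Suc n))"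
      using edge_not_equidistant[OF ray_edge[of "Suc n"], of x] by (simp add: gdist_sym)
    moreover have "d x (w (Suc (Suc n))) \<noteq> d x (w n)"
    proof
      assume "d x (w (Suc (Suc n))) = d x (w n)"
      then have above: "d (w (Suc (Suc n))) x = d x (w n)" by (simp only: gdist_sym[of _ x])
      have "d (w (Suc n)) x = Suc (d x (w n))"
        using step.IH by (simp only: gdist_sym[of _ x])
      from closer_neighbour_unique[OF edge_sym[OF ray_edge] ray_edge this gdist_sym above]
      have "w n = w (Suc (Suc n))" .
      then show False using ray_dist[of n "Suc (Suc n)"] by simp
    qed
    ultimately show ?case using step.IH by simp
  qed
  have far: "d x (w (n0 + k)) = d x (w n0) + k" for k
    by (induction k) (use grow in auto)
  have "lev x = int n - int (d x (w n))" if "n \<ge> n0" for n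
    using far[of "n - n0"] that ray_dist[of 0 n0]
    by (simp add: level_def n0(1) gdist_sym[of x])
  then show ?thesis by blast
qed

lemma level_common:
  obtains n where "\<And>i. i \<ge> n \<Longrightarrow> lev x = int i - int (d x (w i))"
    "\<And>i. i \<ge> n \<Longrightarrow> lev y = int i - int (d y (w i))"
proof -
  obtain n1 n2 where "\<forall>i\<ge>n1. lev x = int i - int (d x (w i))" "\<forall>i\<ge>n2. lev y = int i - int (d y (w i))"
    using level_eventually by metis
  then show ?thesis by (intro that[of "max n1 n2"]) auto
qed

lemma level_lipschitz: "lev x - lev y \<le> int (d x y)"
proof -
  obtain n where n: "\<And>i. i \<ge> n \<Longrightarrow> lev x = int i - int (d x (w i))"
    "\<And>i. i \<ge> n \<Longrightarrow> lev y = int i - int (d y (w i))"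
    using level_common[of x y] by metis
  then show ?thesis
    using n[of n] gdist_triangle[of y "w n" x] gdist_sym[of x y] by simp
qed

text \<open>Any parent of \<open>y\<close> is the neighbour of \<open>y\<close> one step closer to
  \<open>w n\<close> for large \<open>n\<close>, and there is only one such neighbour.\<close>

lemma parent_unique:
  assumes "y \<in> sons E w x" "y \<in> sons E w x'" shows "x = x'"
proof -
  have e: "E y x" "E y x'" and l: "lev x = lev y + 1" "lev x' = lev y + 1"
    using assms edge_sym by (auto simp: sons_def)
  obtain n1 where n1: "\<And>i. i \<ge> n1 \<Longrightarrow> lev x = int i - int (d x (w i))"
    "\<And>i. i \<ge> n1 \<Longrightarrow> lev x' = int i - int (d x' (w i))"
    using level_common[of x x'] by metis
  obtain n2 where n2: "\<And>i. i \<ge> n2 \<Longrightarrow> lev y = int i - int (d y (w i))"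
    using level_common[of y y] by metis
  define n where "n = max n1 n2"
  have "d y (w n) = Suc (d x (w n))" "d x' (w n) = d x (w n)"
    using n1[of n] n2[of n] l unfolding n_def by simp_all
  then show ?thesis using closer_neighbour_unique[OF e] by blast
qed

section \<open>Generations of descendants, and trapezoids as unions of them\<close>

definition desc :: "nat \<Rightarrow> 'a \<Rightarrow> 'a set" where
  "desc k x = {y. d x y = k \<and> lev y = lev x - int k}"

lemma desc_0 [simp]: "desc 0 x = {x}"
  by (auto simp: desc_def gdist_eq_0)

text \<open>A path that drops \<open>Suc k\<close> levels in \<open>Suc k\<close> steps must descend
  at every step, since the level is 1-Lipschitz; hence its first step leads to a son.\<close>

lemma desc_Suc: "desc (Suc k) x = (\<Union>s\<in>sons E w x. desc k s)"
proof (intro subset_antisym subsetI)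
  fix y assume "y \<in> desc (Suc k) x"
  then have y: "d x y = Suc k" "lev y = lev x - int (Suc k)" by (auto simp: desc_def)
  obtain z where z: "E x z" "d z y = k" using closer_neighbour[OF y(1)] by blast
  have "lev z = lev x - 1"
    using level_lipschitz[of z y] level_lipschitz[of x z] gdist_edge[OF z(1)] z(2) y(2) by simp
  then show "y \<in> (\<Union>s\<in>sons E w x. desc k s)"
    using z y by (auto simp: sons_def desc_def intro!: exI[of _ z])
next
  fix y assume "y \<in> (\<Union>s\<in>sons E w x. desc k s)"
  then obtain z where z: "E x z" "lev z = lev x - 1" "d z y = k" "lev y = lev z - int k"
    by (auto simp: sons_def desc_def)
  then show "y \<in> desc (Suc k) x"
    using level_lipschitz[of x y] gdist_edge_le[OF z(1), of y] by (auto simp: desc_def)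
qed

lemma desc_ancestor_unique: "y \<in> desc k x \<Longrightarrow> y \<in> desc k x' \<Longrightarrow> x = x'"
proof (induction k arbitrary: x x')
  case (Suc k)
  then show ?case unfolding desc_Suc by (blast dest: parent_unique)
qed simp

lemma desc_level_unique: "y \<in> desc k x \<Longrightarrow> y \<in> desc l x \<Longrightarrow> k = l"
  by (simp add: desc_def)

definition trap :: "nat \<Rightarrow> nat \<Rightarrow> 'a \<Rightarrow> 'a set" where
  "trap a b x = (\<Union>k\<in>{a..<b}. desc k x)"

text \<open>The bounds of the level interval, strict below and weak above, become the half-open
  range of generations from \<open>a\<close> to \<open>b - 1\<close>.\<close>

lemma trapezoid_eq_trap: "trapezoid E w a b x = trap a b x"
  by (auto simp: trapezoid_def below_def trap_def desc_def)

lemma trap_append: "a \<le> b \<Longrightarrow> b \<le> c \<Longrightarrow> trap a c x = trap a b x \<union> trap b c x"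
  by (fastforce simp: trap_def)

lemma trap_append_disjoint: "trap a b x \<inter> trap b c x = {}"
  by (auto simp: trap_def dest: desc_level_unique)

lemma trap_Suc: "trap (Suc a) (Suc b) x = (\<Union>s\<in>sons E w x. trap a b s)"
proof -
  have "trap (Suc a) (Suc b) x = (\<Union>k\<in>{a..<b}. desc (Suc k) x)"
    unfolding trap_def image_Suc_atLeastLessThan[symmetric] by (simp only: image_image)
  then show ?thesis by (auto simp: desc_Suc trap_def)
qed

text \<open>Two sons have equal level, so a common descendant lies in the same generation below
  both, and its ancestor there is unique.\<close>

lemma trap_sons_disjoint:
  assumes "s \<in> sons E w x" "s' \<in> sons E w x" "s \<noteq> s'"
  shows "trap a b s \<inter> trap a b s' = {}"
proof (rule ccontr)
  assume "trap a b s \<inter> trap a b s' \<noteq> {}"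
  then obtain y k l where y: "y \<in> desc k s" "y \<in> desc l s'" by (auto simp: trap_def)
  then have "k = l" using assms(1,2) by (auto simp: desc_def sons_def)
  then show False using y desc_ancestor_unique assms(3) by blast
qed

end

section \<open>Flow measures and splitting of trapezoids\<close>

text \<open>Local doubling enters as \<open>parent_le\<close>: passing to a son divides the mass by
  at most \<open>C\<close>.\<close>

locale doubling_flow_tree = rooted_tree E w for E :: "'a \<Rightarrow> 'a \<Rightarrow> bool" and w +
  fixes m :: "'a \<Rightarrow> real" and C :: real
  assumes flow: "flow E w m"
    and C_ge_1: "1 \<le> C"
    and parent_le: "y \<in> sons E w x \<Longrightarrow> m x \<le> C * m y"
begin

lemma m_pos: "0 < m x"
  using flow by (simp add: flow_def)

lemma has_sum_sons: "(m has_sum m x) (sons E w x)"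
  using flow by (simp add: flow_def)

text \<open>Local finiteness is a consequence of doubling: every son has mass at least
  \<open>m x / C\<close>, so more than \<open>C\<close> sons would exceed the mass of
  \<open>x\<close>.\<close>

lemma finite_sons: "finite (sons E w x)"
proof (rule ccontr)
  assume inf: "infinite (sons E w x)"
  obtain F where F: "finite F" "card F = Suc (nat \<lceil>C\<rceil>)" "F \<subseteq> sons E w x"
    using infinite_arbitrarily_large[OF inf] by blast
  have "C * m x < real (card F) * m x"
    using F(2) m_pos[of x] by (intro mult_strict_right_mono) linarith+
  also have "\<dots> = (\<Sum>y\<in>F. m x)" by simp
  also have "\<dots> \<le> (\<Sum>y\<in>F. C * m y)" using F(3) parent_le by (intro sum_mono) auto
  also have "\<dots> = C * sum m F" by (simp add: sum_distrib_left)
  also have "sum m F \<le> m x"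
    using has_sum_mono2[OF has_sum_finite[OF F(1)] has_sum_sons F(3)] m_pos less_imp_le by blast
  finally show False using C_ge_1 by simp
qed

lemma sum_sons: "sum m (sons E w x) = m x"
  using has_sum_sons[of x] by (simp add: has_sum_finite_iff[OF finite_sons])

lemma sons_nonempty: "sons E w x \<noteq> {}"
  using sum_sons[of x] m_pos[of x] by auto

lemma finite_desc: "finite (desc k x)"
  by (induction k arbitrary: x) (auto simp: desc_Suc finite_sons)

lemma desc_nonempty: "desc k x \<noteq> {}"
  by (induction k arbitrary: x) (use sons_nonempty in \<open>auto simp: desc_Suc\<close>)

text \<open>The flow condition iterates: every generation below \<open>x\<close> carries the full
  mass of \<open>x\<close>. The mass of a trapezoid is therefore \<open>m x\<close> times its number
  of generations.\<close>

lemma sum_desc: "sum m (desc k x) = m x"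
proof (induction k arbitrary: x)
  case (Suc k)
  have "sum m (desc (Suc k) x) = (\<Sum>s\<in>sons E w x. sum m (desc k s))"
    unfolding desc_Suc
    by (intro sum.UNION_disjoint) (auto simp: finite_sons finite_desc dest: desc_ancestor_unique)
  then show ?case using Suc sum_sons by simp
qed simp

lemma m_desc: "y \<in> desc k x \<Longrightarrow> m x \<le> C ^ k * m y"
proof (induction k arbitrary: x)
  case (Suc k)
  then obtain s where s: "s \<in> sons E w x" "y \<in> desc k s" by (auto simp: desc_Suc)
  have "m x \<le> C * m s" by (rule parent_le[OF s(1)])
  also have "\<dots> \<le> C * (C ^ k * m y)" using Suc.IH[OF s(2)] C_ge_1 by (intro mult_left_mono) auto
  finally show ?case by simp
qed simp

lemma finite_trap: "finite (trap a b x)"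
  by (simp add: trap_def finite_desc)

lemma trap_nonempty: "a < b \<Longrightarrow> trap a b x \<noteq> {}"
  using desc_nonempty by (auto simp: trap_def)

lemma sum_trap: "sum m (trap a b x) = real (b - a) * m x"
proof -
  have "sum m (trap a b x) = (\<Sum>k\<in>{a..<b}. sum m (desc k x))"
    unfolding trap_def
    by (intro sum.UNION_disjoint) (auto simp: finite_desc dest: desc_level_unique)
  then show ?thesis by (simp add: sum_desc)
qed

section \<open>Admissible trapezoids and their partitions\<close>

lemma trap_admissible:
  assumes "1 \<le> a" "2 * a \<le> b" "real b \<le> \<beta> * real a"
  shows "trap a b x \<in> admissible E w \<beta>"
proof -
  have "real (2 * a) \<le> real b" using assms(2) by (simp only: of_nat_le_iff)
  then have "2 \<le> real b / real a" "real b / real a \<le> \<beta>"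
    using assms(1,3) by (simp_all add: le_divide_eq divide_le_eq)
  then show ?thesis
    using assms unfolding admissible_def trapezoid_eq_trap
    by (intro UnI2 CollectI exI[of _ a] exI[of _ b] exI[of _ x]) auto
qed

lemma admissible_cases:
  assumes "R \<in> admissible E w \<beta>"
  obtains x where "R = {x}"
  | a b x where "R = trap a b x" "1 \<le> a" "2 * a \<le> b" "real b \<le> \<beta> * real a"
proof -
  have "(\<exists>x. R = {x}) \<or> (\<exists>a b x. R = trap a b x \<and> 1 \<le> a \<and> 2 \<le> real b / real a \<and> real b / real a \<le> \<beta>)"
    using assms unfolding admissible_def trapezoid_eq_trap by blast
  then show ?thesis
  proof (elim disjE exE conjE)
    fix a b x assume *: "R = trap a b x" "1 \<le> a" "2 \<le> real b / real a" "real b / real a \<le> \<beta>"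
    then have "real (2 * a) \<le> real b" "real b \<le> \<beta> * real a" by (simp_all add: field_simps)
    then show ?thesis using that(2) * by (metis of_nat_le_iff)
  qed (rule that(1))
qed

text \<open>A common lower bound for the mass ratios in all splittings: the full product is needed
  for singletons, while \<open>1 / \<beta>\<close> and \<open>1 / 2\<close> serve the horizontal cut
  and \<open>1 / C\<close> the cut at the sons.\<close>

definition split_const :: "real \<Rightarrow> real" where
  "split_const \<beta> = 1 / (\<beta> * C ^ nat \<lceil>\<beta>\<rceil>)"

lemma split_const_le:
  assumes "12 \<le> \<beta>"
  shows "0 < split_const \<beta>" "split_const \<beta> \<le> 1 / \<beta>" "split_const \<beta> \<le> 1 / C" "split_const \<beta> \<le> 1 / 2"
proof -
  have 1: "1 \<le> C ^ nat \<lceil>\<beta>\<rceil>" using C_ge_1 by simp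
  have "1 \<le> nat \<lceil>\<beta>\<rceil>" using assms by linarith
  from power_increasing[OF this C_ge_1] have 2: "C \<le> C ^ nat \<lceil>\<beta>\<rceil>" by simp
  have "\<beta> * 1 \<le> \<beta> * C ^ nat \<lceil>\<beta>\<rceil>" using assms 1 by (intro mult_left_mono) auto
  moreover from this have "2 \<le> \<beta> * C ^ nat \<lceil>\<beta>\<rceil>" using assms by linarith
  moreover have "1 * C \<le> \<beta> * C ^ nat \<lceil>\<beta>\<rceil>" using assms 2 C_ge_1 by (intro mult_mono) auto
  ultimately show "0 < split_const \<beta>" "split_const \<beta> \<le> 1 / \<beta>" "split_const \<beta> \<le> 1 / C"
    "split_const \<beta> \<le> 1 / 2"
    unfolding split_const_def using assms C_ge_1 by (auto intro!: divide_left_mono frac_le)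
qed

text \<open>The induction on \<open>a\<close> deals with vertices having a single son: there the cut
  at the sons returns the same set, now seen as a trapezoid of the son with smaller
  \<open>a\<close>.\<close>

lemma trap_split:
  assumes \<beta>: "12 \<le> \<beta>" and "1 \<le> a" "2 * a \<le> b" "real b \<le> \<beta> * real a"
  shows "(\<exists>y. trap a b x = {y}) \<or>
    (\<exists>\<C>\<subseteq>admissible E w \<beta>. disjoint \<C> \<and> \<Union>\<C> = trap a b x \<and> trap a b x \<notin> \<C> \<and>
      (\<forall>Q\<in>\<C>. split_const \<beta> * sum m (trap a b x) \<le> sum m Q))"
  using assms(2-)
proof (induction a arbitrary: b x rule: nat_induct_at_least)
  case base
  let ?P = "trap 1 b x" and ?\<C> = "(\<lambda>y. {y}) ` trap 1 b x"
  have b: "real b \<le> \<beta>" "2 \<le> b" using base by auto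
  \<comment> \<open>With \<open>a = 1\<close> the depth is below \<open>b \<le> \<beta>\<close>, so
    each vertex keeps at least the fraction \<open>1 / C ^ nat \<lceil>\<beta>\<rceil>\<close> of
    \<open>m x\<close>, and there are at most \<open>\<beta>\<close> generations.\<close>
  have "split_const \<beta> * sum m ?P \<le> m y" if y: "y \<in> ?P" for y
  proof -
    obtain k where k: "k < b" "y \<in> desc k x" using y by (auto simp: trap_def)
    have "m x \<le> C ^ k * m y" by (rule m_desc[OF k(2)])
    also have "\<dots> \<le> C ^ nat \<lceil>\<beta>\<rceil> * m y"
      using k(1) b(1) C_ge_1 m_pos[of y] by (intro mult_right_mono power_increasing) (auto, linarith)
    finally have "real (b - 1) * m x \<le> \<beta> * (C ^ nat \<lceil>\<beta>\<rceil> * m y)"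
      using b m_pos[of x] \<beta> by (intro mult_mono) auto
    then show ?thesis
      using \<beta> C_ge_1 by (simp add: split_const_def sum_trap field_simps)
  qed
  moreover have "?\<C> \<subseteq> admissible E w \<beta>" by (auto simp: admissible_def)
  moreover have "disjoint ?\<C>" by (auto simp: disjoint_def)
  ultimately show ?case
    \<comment> \<open>A one-point trapezoid would be its own only part, hence the case
      distinction.\<close>
    by (cases "\<exists>y. ?P = {y}") (auto intro!: exI[of _ ?\<C>])
next
  case (Suc a)
  let ?P = "trap (Suc a) b x"
  show ?case
  proof (cases "4 * Suc a \<le> b")
    case True
    \<comment> \<open>Cutting at twice the upper depth gives \<open>?T\<close> the ratio 2, while
      \<open>?U\<close> keeps a ratio between 2 and \<open>\<beta> / 2\<close>.\<close>
    let ?T = "trap (Suc a) (2 * Suc a) x" and ?U = "trap (2 * Suc a) b x"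
    have un: "?P = ?T \<union> ?U" using True by (intro trap_append) auto
    have dj: "?T \<inter> ?U = {}" by (rule trap_append_disjoint)
    have ne: "?T \<noteq> {}" "?U \<noteq> {}" using True by (auto intro!: trap_nonempty)
    have "?T \<in> admissible E w \<beta>"
    proof (rule trap_admissible)
      have "2 * real (Suc a) \<le> \<beta> * real (Suc a)" using \<beta> by (intro mult_right_mono) auto
      then show "real (2 * Suc a) \<le> \<beta> * real (Suc a)" by (simp only: of_nat_mult of_nat_numeral)
    qed auto
    moreover have "?U \<in> admissible E w \<beta>"
    proof (rule trap_admissible)
      have "\<beta> * real (Suc a) \<le> \<beta> * real (2 * Suc a)" using \<beta> by (intro mult_left_mono) auto
      then show "real b \<le> \<beta> * real (2 * Suc a)" using Suc.prems(2) by linarith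
    qed (use True in auto)
    moreover have "split_const \<beta> * sum m ?P \<le> sum m ?T"
    proof -
      have "split_const \<beta> * real (b - Suc a) \<le> 1 / \<beta> * (\<beta> * real (Suc a))"
        using split_const_le[OF \<beta>] \<beta> Suc.prems(2) True by (intro mult_mono) auto
      then have "split_const \<beta> * real (b - Suc a) \<le> real (2 * Suc a - Suc a)" using \<beta> by simp
      from mult_right_mono[OF this less_imp_le[OF m_pos[of x]]] show ?thesis
        by (simp only: sum_trap mult.assoc)
    qed
    \<comment> \<open>Since \<open>b\<close> is at least \<open>4 * Suc a\<close>, the lower piece
      retains at least half of the generations.\<close>
    moreover have "split_const \<beta> * sum m ?P \<le> sum m ?U"
    proof -
      have "split_const \<beta> * real (b - Suc a) \<le> 1 / 2 * real (b - Suc a)"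
        using split_const_le[OF \<beta>] by (intro mult_right_mono) auto
      also have "\<dots> \<le> real (b - 2 * Suc a)" using True by (auto simp: of_nat_diff)
      finally have "split_const \<beta> * real (b - Suc a) \<le> real (b - 2 * Suc a)" .
      from mult_right_mono[OF this less_imp_le[OF m_pos[of x]]] show ?thesis
        by (simp only: sum_trap mult.assoc)
    qed
    moreover have "disjoint {?T, ?U}" using dj by (auto simp: disjoint_def)
    moreover have "?P \<notin> {?T, ?U}" using un dj ne by blast
    ultimately show ?thesis
      using un by (intro disjI2 exI[of _ "{?T, ?U}"]) auto
  next
    case False
    obtain b' where b': "b = Suc b'" using Suc.prems by (cases b) auto
    have P: "?P = (\<Union>s\<in>sons E w x. trap a b' s)" unfolding b' by (rule trap_Suc)
    have ab: "2 * a \<le> b'" "a < b'" using Suc b' by auto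
    \<comment> \<open>Here \<open>b < 4 * Suc a\<close>, so the cut at the sons has ratio at most 7.\<close>
    have "real b' \<le> 7 * real a" using False b' Suc.hyps by simp
    also have "\<dots> \<le> \<beta> * real a" using \<beta> by (intro mult_right_mono) auto
    finally have r: "real b' \<le> \<beta> * real a" .
    show ?thesis
    proof (cases "\<exists>s. sons E w x = {s}")
      case True
      then obtain s where "sons E w x = {s}" by blast
      then have "?P = trap a b' s" using P by simp
      then show ?thesis using Suc.IH[OF ab(1) r, of s] by simp
    next
      case not1: False
      let ?\<C> = "(\<lambda>s. trap a b' s) ` sons E w x"
      have "?\<C> \<subseteq> admissible E w \<beta>" using trap_admissible[OF Suc.hyps ab(1) r] by blast
      moreover have "disjoint ?\<C>" using trap_sons_disjoint by (fastforce simp: disjoint_def)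
      moreover have "?P \<notin> ?\<C>"
      proof
        assume "?P \<in> ?\<C>"
        then obtain s where s: "s \<in> sons E w x" "?P = trap a b' s" by blast
        obtain s' where s': "s' \<in> sons E w x" "s' \<noteq> s" using not1 s by blast
        have "trap a b' s' \<subseteq> trap a b' s" using s' P s(2) by blast
        then show False using trap_sons_disjoint[OF s(1) s'(1), of a b'] s'(2) trap_nonempty[OF ab(2)] by blast
      qed
      \<comment> \<open>Both trapezoids have the same number of generations, so the ratio of masses
        is that of \<open>s\<close> to \<open>x\<close>.\<close>
      moreover have "split_const \<beta> * sum m ?P \<le> sum m (trap a b' s)" if s: "s \<in> sons E w x" for s
      proof -
        have "split_const \<beta> * m x \<le> 1 / C * (C * m s)"
          using split_const_le[OF \<beta>] parent_le[OF s] m_pos[of x] C_ge_1 by (intro mult_mono) auto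
        then have "split_const \<beta> * m x \<le> m s" using C_ge_1 by simp
        from mult_left_mono[OF this, of "real (b' - a)"] show ?thesis
          by (simp add: sum_trap b' mult.left_commute)
      qed
      ultimately show ?thesis using P by (intro disjI2 exI[of _ ?\<C>]) auto
    qed
  qed
qed

lemma splitting_family_admissible:
  assumes \<beta>: "12 \<le> \<beta>"
  shows "splitting_family m (admissible E w \<beta>) (split_const \<beta>)"
proof
  fix P assume P: "P \<in> admissible E w \<beta>"
  show "finite P" using P by (cases rule: admissible_cases) (auto simp: finite_trap)
  show "P \<noteq> {}"
    using P by (cases rule: admissible_cases) (auto intro!: trap_nonempty)
  show "(\<exists>x. P = {x}) \<or> (\<exists>\<C>\<subseteq>admissible E w \<beta>. disjoint \<C> \<and> \<Union>\<C> = P \<and> P \<notin> \<C> \<and>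
      (\<forall>Q\<in>\<C>. split_const \<beta> * sum m P \<le> sum m Q))"
    using P
  proof (cases rule: admissible_cases)
    case (2 a b x)
    show ?thesis unfolding 2(1) by (rule trap_split[OF \<beta> 2(2-)])
  qed auto
qed (use m_pos split_const_le[OF \<beta>] in auto)

end

section \<open>Integrals against a flow measure\<close>

lemma sets_flow_measure [simp]: "sets (flow_measure m) = UNIV"
  by (simp add: flow_measure_def point_measure_def)

lemma space_flow_measure [simp]: "space (flow_measure m) = UNIV"
  by (simp add: flow_measure_def point_measure_def)

lemma nn_integral_flow_measure:
  assumes "finite R" "\<And>x. 0 \<le> m x" "\<And>x. 0 \<le> g x"
  shows "(\<integral>\<^sup>+x\<in>R. ennreal (g x) \<partial>flow_measure m) = ennreal (\<Sum>x\<in>R. m x * g x)"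
proof -
  have "(\<integral>\<^sup>+x\<in>R. ennreal (g x) \<partial>flow_measure m)
      = (\<integral>\<^sup>+x. ennreal (m x) * (ennreal (g x) * indicator R x) \<partial>count_space UNIV)"
    unfolding flow_measure_def point_measure_def by (subst nn_integral_density) auto
  also have "\<dots> = (\<Sum>x\<in>R. ennreal (m x) * (ennreal (g x) * indicator R x))"
    by (rule nn_integral_count_space') (use assms(1) in auto)
  also have "\<dots> = (\<Sum>x\<in>R. ennreal (m x * g x))"
    by (intro sum.cong) (auto simp: ennreal_mult assms)
  also have "\<dots> = ennreal (\<Sum>x\<in>R. m x * g x)" by (rule sum_ennreal) (simp add: assms)
  finally show ?thesis .
qed

lemma emeasure_flow_measure:
  assumes "finite R" "\<And>x. 0 \<le> m x"
  shows "emeasure (flow_measure m) R = ennreal (sum m R)"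
  using nn_integral_flow_measure[OF assms, of "\<lambda>_. 1"] by simp

lemma average_flow_measure:
  assumes "finite R" "\<And>x. 0 \<le> m x"
  shows "average (flow_measure m) R f = (\<Sum>x\<in>R. m x *\<^sub>R f x) /\<^sub>R sum m R"
proof -
  have "set_lebesgue_integral (flow_measure m) R f
      = (\<integral>x. m x *\<^sub>R (indicator R x *\<^sub>R f x) \<partial>count_space UNIV)"
    unfolding set_lebesgue_integral_def flow_measure_def point_measure_def
    by (subst integral_density) (use assms(2) in auto)
  also have "\<dots> = (\<Sum>x | x \<in> UNIV \<and> m x *\<^sub>R (indicator R x *\<^sub>R f x) \<noteq> 0. m x *\<^sub>R (indicator R x *\<^sub>R f x))"
    by (rule lebesgue_integral_count_space_finite_support)
      (rule finite_subset[OF _ assms(1)], auto split: split_indicator_asm)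
  also have "\<dots> = (\<Sum>x\<in>R. m x *\<^sub>R f x)"
    using assms(1) by (intro sum.mono_neutral_cong_left) (auto split: split_indicator_asm)
  finally show ?thesis
    using emeasure_flow_measure[OF assms] assms(2) by (simp add: average_def measure_def sum_nonneg)
qed

text \<open>Doubling at radius \<open>1 / 2\<close> suffices: the ball of radius
  \<open>1 / 2\<close> around a son is the son alone, and the ball of radius 1 already contains its
  parent.\<close>

lemma (in rooted_tree) doubling_parent_le:
  assumes "flow E w m" "locally_doubling E (flow_measure m)"
  shows "\<exists>C\<ge>1. \<forall>x. \<forall>y\<in>sons E w x. m x \<le> C * m y"
proof -
  have pos: "0 < m x" for x using assms(1) by (simp add: flow_def)
  let ?M = "flow_measure m"
  obtain C where C: "C > 1" "\<And>x. emeasure ?M (gball E (2 * (1/2)) x) \<le> ennreal C * emeasure ?M (gball E (1/2) x)"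
    using assms(2) unfolding locally_doubling_def by (metis half_gt_zero zero_less_one)
  have "m x \<le> C * m y" if "y \<in> sons E w x" for x y
  proof -
    have "E y x" using that edge_sym by (auto simp: sons_def)
    then have "{x} \<subseteq> gball E 1 y" by (auto simp: gball_def gdist_edge)
    then have "emeasure ?M {x} \<le> emeasure ?M (gball E 1 y)" by (intro emeasure_mono) auto
    also have "\<dots> \<le> ennreal C * emeasure ?M (gball E (1/2) y)" using C(2)[of y] by simp
    also have "real n \<le> 1 / 2 \<longleftrightarrow> n = 0" for n by (cases n) auto
    then have "gball E (1/2) y = {y}"
      by (auto simp: gball_def gdist_eq_0 simp del: of_nat_le_iff)
    finally have "ennreal (m x) \<le> ennreal (C * m y)"
      using emeasure_flow_measure[of "{x}" m] emeasure_flow_measure[of "{y}" m]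
        less_imp_le[OF pos] C(1) by (simp add: ennreal_mult)
    then show ?thesis using C(1) pos[of y] by simp
  qed
  then show ?thesis using C(1) by (meson less_imp_le)
qed

section \<open>The two estimates for admissible sets\<close>

theorem theorem4p2:
  fixes E :: "'a \<Rightarrow> 'a \<Rightarrow> bool"
    and w :: "nat \<Rightarrow> 'a"
    and m :: "'a \<Rightarrow> real"
    and \<beta> :: real
  defines "M \<equiv> flow_measure m"
    and "\<R> \<equiv> admissible E w \<beta>"
  assumes "graph_tree E"
    and "geodesic_ray E w"
    and "flow E w m"
    and "locally_doubling E M"
    and "12 \<le> \<beta>"
  shows "\<exists>\<eta>>0. \<exists>A>0. \<forall>f \<in> bmo M \<R>.
    (\<not> f constant_on UNIV \<longrightarrow>
       (SUP R\<in>\<R>. (\<integral>\<^sup>+x\<in>R. ennreal (exp (\<eta> / enn2real (bmo_norm M \<R> f) * cmod (f x - average M R f))) \<partial>M)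
          / emeasure M R) \<le> ennreal A) \<and>
    (\<forall>t>0. \<forall>R\<in>\<R>.
       emeasure M {x \<in> R. cmod (f x - average M R f) > t * enn2real (bmo_norm M \<R> f)}
         \<le> ennreal (A * exp (- \<eta> * t)) * emeasure M R)"
proof -
  interpret rooted_tree E w
    using assms by unfold_locales
  obtain C where C: "C \<ge> 1" "\<And>x y. y \<in> sons E w x \<Longrightarrow> m x \<le> C * m y"
    using doubling_parent_le assms(5,6) unfolding M_def by blast
  interpret doubling_flow_tree E w m C
    using C assms(5) by unfold_locales
  interpret splitting_family m \<R> "split_const \<beta>"
    unfolding \<R>_def by (rule splitting_family_admissible[OF assms(7)])
  \<comment> \<open>This depends only on \<open>\<beta>\<close> and the constant \<open>C\<close>
    obtained from doubling, so it is fixed before \<open>f\<close>.\<close>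
  define \<eta> where "\<eta> = ln 2 / (4 + 1 / split_const \<beta>)"
  have \<eta>: "0 < \<eta>" unfolding \<eta>_def using c_pos by (simp add: add_pos_pos)
  have m0: "0 \<le> m x" for x using m_pos less_imp_le by blast
  have em: "emeasure M P = ennreal (sum m P)" if "finite P" for P
    unfolding M_def by (rule emeasure_flow_measure[OF that m0])
  have int: "(\<integral>\<^sup>+x\<in>R. ennreal (g x) \<partial>M) = ennreal (\<Sum>x\<in>R. m x * g x)"
    if "R \<in> \<R>" "\<And>x. 0 \<le> g x" for R g
    unfolding M_def by (rule nn_integral_flow_measure[OF finite_member[OF that(1)] m0 that(2)])
  have av: "average M R f = avg f R" if "R \<in> \<R>" for R f
    unfolding M_def avg_def by (rule average_flow_measure[OF finite_member[OF that] m0])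
  {
    fix f assume "f \<in> bmo M \<R>"
    define B where "B = enn2real (bmo_norm M \<R> f)"
    have B0: "0 \<le> B" by (simp add: B_def)
    have norm: "bmo_norm M \<R> f = ennreal B"
      using \<open>f \<in> bmo M \<R>\<close> by (simp add: B_def bmo_def)
    have osc: "(\<Sum>x\<in>R. m x * cmod (f x - avg f R)) \<le> B * sum m R" if R: "R \<in> \<R>" for R
    proof -
      have "(\<integral>\<^sup>+x\<in>R. ennreal (cmod (f x - average M R f)) \<partial>M) / emeasure M R \<le> ennreal B"
        unfolding norm[symmetric] bmo_norm_def by (rule SUP_upper[OF R])
      then have "ennreal ((\<Sum>x\<in>R. m x * cmod (f x - avg f R)) / sum m R) \<le> ennreal B"
        using sum_m_pos[OF R] m0
        by (simp add: int[OF R] em[OF finite_member[OF R]] av[OF R] divide_ennreal sum_nonneg)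
      then show ?thesis using sum_m_pos[OF R] B0 by (simp add: field_simps)
    qed
    have jn: "(\<Sum>x\<in>R. m x * exp (\<eta> / B * cmod (f x - avg f R))) \<le> 4 * sum m R" if R: "R \<in> \<R>" for R
    proof (cases "B = 0")
      case True
      \<comment> \<open>Division by zero yields 0, so the exponential is constantly 1 here.\<close>
      then show ?thesis using sum_m_pos[OF R] by simp
    next
      case False
      then show ?thesis
        using john_nirenberg_sum[of B f R] osc R B0 unfolding \<eta>_def by simp
    qed
    have "(\<integral>\<^sup>+x\<in>R. ennreal (exp (\<eta> / B * cmod (f x - average M R f))) \<partial>M) / emeasure M R
        \<le> ennreal 4" if R: "R \<in> \<R>" for R
      using jn[OF R] sum_m_pos[OF R] m0
      by (simp add: int[OF R] em[OF finite_member[OF R]] av[OF R] divide_ennreal sum_nonneg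
          divide_le_eq flip: ennreal_numeral)
    then have i: "(SUP R\<in>\<R>. (\<integral>\<^sup>+x\<in>R. ennreal (exp (\<eta> / B * cmod (f x - average M R f))) \<partial>M)
        / emeasure M R) \<le> ennreal 4" by (rule SUP_least)
    have ii: "emeasure M {x \<in> R. cmod (f x - average M R f) > t * B}
        \<le> ennreal (4 * exp (- \<eta> * t)) * emeasure M R" if t: "t > 0" and R: "R \<in> \<R>" for t R
    proof -
      let ?L = "{x \<in> R. cmod (f x - avg f R) > t * B}"
      note fin = finite_member[OF R]
      have "sum m ?L \<le> 4 * exp (- \<eta> * t) * sum m R"
      proof (cases "B = 0")
        case True
        \<comment> \<open>With norm zero, \<open>f\<close> equals its average on \<open>R\<close>,
          and the strict inequality defining \<open>?L\<close> reads \<open>0 < 0\<close>.\<close>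
        have "\<forall>x\<in>R. m x * cmod (f x - avg f R) = 0"
          using osc[OF R] True sum_nonneg_eq_0_iff[OF fin, of "\<lambda>x. m x * cmod (f x - avg f R)"] m0
          by (simp add: antisym sum_nonneg)
        then have "?L = {}" using m_pos True by (auto simp: less_imp_neq[symmetric])
        then show ?thesis using sum_m_pos[OF R] by (simp only: sum.empty) simp
      next
        case False
        \<comment> \<open>Markov's inequality for the exponential: on \<open>?L\<close> the
          integrand is at least \<open>exp (\<eta> * t)\<close>.\<close>
        have "exp (\<eta> * t) * sum m ?L = (\<Sum>x\<in>?L. m x * exp (\<eta> * t))"
          by (simp add: sum_distrib_left mult.commute)
        also have "\<dots> \<le> (\<Sum>x\<in>?L. m x * exp (\<eta> / B * cmod (f x - avg f R)))"
        proof (intro sum_mono mult_left_mono m0)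
          fix x assume "x \<in> ?L"
          then have "\<eta> / B * (t * B) \<le> \<eta> / B * cmod (f x - avg f R)"
            using \<eta> B0 by (intro mult_left_mono) auto
          then show "exp (\<eta> * t) \<le> exp (\<eta> / B * cmod (f x - avg f R))" using False by simp
        qed
        also have "\<dots> \<le> (\<Sum>x\<in>R. m x * exp (\<eta> / B * cmod (f x - avg f R)))"
          using fin m0 by (intro sum_mono2) auto
        also have "\<dots> \<le> 4 * sum m R" by (rule jn[OF R])
        finally show ?thesis by (simp add: exp_minus field_simps)
      qed
      then show ?thesis
        using fin sum_m_pos[OF R] by (simp add: av[OF R] em ennreal_leI flip: ennreal_mult)
    qed
    note i ii
  }
  then show ?thesis
    using \<eta> by (intro exI[of _ \<eta>] conjI exI[of _ 4]) (auto simp del: ennreal_numeral)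
qed

end
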